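(* Let $T>0$, $\lambda>0$, $\Delta t=T/N$, and let $A,U,B,V$ be real matrices of compatible sizes, independent of $\Delta t$. Put $G_{\rm GLM}=V-\Delta t^2\lambda B[I+\Delta t^2\lambda A]^{-1}U$, and let $E^n$, $\bm e^{[n]}$, $T^n$, $\bm\theta^{[n]}$ be vectors satisfying, for $n=0,\dots,N-1$, $$E^{n+1}+\Delta t^2\lambda A E^{n+1}=U\bm e^{[n]}+T^n,\qquad \bm e^{[n+1]}=G_{\rm GLM}\,\bm e^{[n]}+\bm\theta^{[n]} .$$ Let $G_{\rm GLM}=WDW^{-1}$ be the eigen-decomposition of $G_{\rm GLM}$, with $D$ the diagonal matrix of the eigenvalues of $G_{\rm GLM}$, and assume $\rho(G_{\rm GLM})\le1$. If $\bm e^{[0]}=\bm0$, $E^0=\bm0$, $W=O(\Delta t^q)$, $W^{-1}\bm\theta^{[n]}=O(\Delta t^{p+1})$ and $T^n=O(\Delta t^{a+1})$ for some integer $q$ and some $a,p\in\mathbb{N}^+$, then $\bm e^{[n]}=O(\Delta t^{q+p})$ and $E^n=O(\Delta t^{\min(a+1,\,q+p)})$.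
   Context: All $O(\cdot)$ are for $\Delta t\to0$ ($T,\lambda$ fixed), uniformly in $n$, with Euclidean vector norms and the induced matrix norm. $\rho$ is the spectral radius. These are the error equations of a general linear method $Y^{n+1}+\Delta t^2\lambda AY^{n+1}=U\bm y^{[n]}$, $\bm y^{[n+1]}=G_{\rm GLM}\bm y^{[n]}$ approximating exact vectors $\widehat Y^n,\widehat{\bm y}^{[n]}$: $E^n=\widehat Y^n-Y^n$, $\bm e^{[n]}=\widehat{\bm y}^{[n]}-\bm y^{[n]}$, and $T^n,\bm\theta^{[n]}$ are the residuals obtained by inserting the exact vectors into the two equations. *)

theory Defs
  imports "HOL-Analysis.Analysis" "HOL-Library.Landau_Symbols"
begin

definition step_size :: "real \<Rightarrow> nat \<Rightarrow> real" where
  "step_size T N = T / real N"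

(* matrix_inv is only meaningful for an invertible argument; mat 1 + (h^2 * lam) A is invertible
   for all sufficiently small h, whatever A is. *)
definition G_GLM ::
  "real^'s^'s \<Rightarrow> real^'r^'s \<Rightarrow> real^'s^'r \<Rightarrow> real^'r^'r \<Rightarrow> real \<Rightarrow> real \<Rightarrow> real^'r^'r" where
  "G_GLM A U B V lam h =
     V - (h\<^sup>2 * lam) *\<^sub>R (B ** matrix_inv (mat 1 + (h\<^sup>2 * lam) *\<^sub>R A) ** U)"

definition cvec :: "real^'n \<Rightarrow> complex^'n" where
  "cvec v = (\<chi> i. complex_of_real (v $ i))"

definition cmatrix :: "real^'n^'m \<Rightarrow> complex^'n^'m" where
  "cmatrix = map_matrix complex_of_real"

definition eigenvalues :: "complex^'n^'n \<Rightarrow> complex set" where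
  "eigenvalues M = {z. \<exists>v. v \<noteq> 0 \<and> M *v v = z *s v}"

(* The set of eigenvalues is finite and nonempty, so Max is not degenerate. *)
definition spectral_radius :: "complex^'n^'n \<Rightarrow> real" where
  "spectral_radius M = Max (cmod ` eigenvalues M)"

(* The conditions force the diagonal entries of D to be exactly the eigenvalues of M;
   see eigen_decomposition_eigenvalues. *)
definition eigen_decomposition ::
  "complex^'n^'n \<Rightarrow> complex^'n^'n \<Rightarrow> complex^'n^'n \<Rightarrow> bool" where
  "eigen_decomposition M W D \<longleftrightarrow>
     invertible W \<and> (\<forall>i j. i \<noteq> j \<longrightarrow> D $ i $ j = 0) \<and> M = W ** D ** matrix_inv W"

(* The induced Euclidean norm: norm on real^'n^'m and complex^'n^'m is the Frobenius norm. *)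
definition matrix_norm :: "complex^'n^'m \<Rightarrow> real" where
  "matrix_norm M = onorm (\<lambda>v. M *v v)"

(* f N n = O(g N) as N tends to infinity, uniformly in n \<in> I N. *)
definition uniform_bigo ::
  "(nat \<Rightarrow> nat set) \<Rightarrow> (nat \<Rightarrow> nat \<Rightarrow> 'v::real_normed_vector) \<Rightarrow> (nat \<Rightarrow> real) \<Rightarrow> bool" where
  "uniform_bigo I f g \<longleftrightarrow>
     (\<exists>C. \<forall>\<^sub>F N in sequentially. \<forall>n\<in>I N. norm (f N n) \<le> C * \<bar>g N\<bar>)"

lemma eigen_decomposition_eigenvalues:
  assumes "eigen_decomposition M W D"
  shows "eigenvalues M = range (\<lambda>i. D $ i $ i)"
proof -
  from assms have W: "invertible W" and D: "\<And>i j. i \<noteq> j \<Longrightarrow> D $ i $ j = 0"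
    and M: "M = W ** D ** matrix_inv W"
    by (auto simp: eigen_decomposition_def)
  have inv: "W ** matrix_inv W = mat 1" "matrix_inv W ** W = mat 1"
    using W unfolding invertible_def matrix_inv_def by (metis (mono_tags, lifting) someI_ex)+
  have Dv: "(D *v v) $ i = D $ i $ i * v $ i" for v i
  proof -
    have "(\<Sum>j\<in>UNIV. D $ i $ j * v $ j) =
        (\<Sum>j\<in>UNIV. if j = i then D $ i $ i * v $ i else 0)"
      by (rule sum.cong) (auto simp: D)
    then show ?thesis by (simp add: matrix_vector_mult_def)
  qed
  show ?thesis
  proof (intro equalityI subsetI)
    fix z assume "z \<in> eigenvalues M"
    then obtain v where v: "v \<noteq> 0" "M *v v = z *s v" by (auto simp: eigenvalues_def)
    define w where "w = matrix_inv W *v v"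
    have Ww: "W *v w = v"
      by (simp add: w_def matrix_vector_mul_assoc inv)
    then have "w \<noteq> 0" using v(1) by auto
    then obtain i where i: "w $ i \<noteq> 0" by (auto simp: vec_eq_iff)
    have "matrix_inv W *v (M *v v) = D *v w"
      by (simp add: M w_def matrix_vector_mul_assoc matrix_mul_assoc inv)
    moreover have "matrix_inv W *v (z *s v) = z *s w"
      by (simp add: w_def vector_scalar_commute)
    ultimately have "(D *v w) $ i = (z *s w) $ i" using v(2) by simp
    with i show "z \<in> range (\<lambda>i. D $ i $ i)" by (auto simp: Dv)
  next
    fix z assume "z \<in> range (\<lambda>i. D $ i $ i)"
    then obtain i where z: "z = D $ i $ i" by auto
    define w :: "complex^'a" where "w = axis i 1"
    have Dw: "D *v w = z *s w"
      by (auto simp: vec_eq_iff Dv z w_def axis_def)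
    have "matrix_inv W *v (W *v w) = w"
      by (simp add: matrix_vector_mul_assoc inv)
    moreover have "w \<noteq> 0" by (simp add: w_def)
    ultimately have "W *v w \<noteq> 0" by auto
    moreover have "M *v (W *v w) = W *v (D *v (matrix_inv W *v (W *v w)))"
      by (simp only: M matrix_vector_mul_assoc matrix_mul_assoc)
    then have "M *v (W *v w) = z *s (W *v w)"
      using \<open>matrix_inv W *v (W *v w) = w\<close> by (simp add: Dw vector_scalar_commute)
    ultimately show "z \<in> eigenvalues M" by (auto simp: eigenvalues_def)
  qed
qed

end

theory Submission imports Defs begin

text \<open>
  In the eigenbasis the error recursion decouples into scalar ones. With
  \<open>w\<^sup>n = W\<^sup>-\<^sup>1 e\<^sup>n\<close> it reads \<open>w\<^sup>n\<^sup>+\<^sup>1 = D w\<^sup>n + W\<^sup>-\<^sup>1 \<theta>\<^sup>n\<close>, and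
  \<open>\<rho>(G) \<le> 1\<close> makes the diagonal matrix \<open>D\<close> a contraction of the Euclidean norm,
  although \<open>G\<close> itself need not be one. The local errors therefore at most add up: after
  \<open>n \<le> N = T / \<Delta>t\<close> steps of size \<open>O(\<Delta>t\<^sup>p\<^sup>+\<^sup>1)\<close> each, \<open>w\<^sup>n = O(\<Delta>t\<^sup>p)\<close>, one power of \<open>\<Delta>t\<close> being
  lost to the number of steps. Going back through \<open>e\<^sup>n = W w\<^sup>n\<close> costs the factor
  \<open>O(\<Delta>t\<^sup>q)\<close>; the condition number of \<open>W\<close> never enters, because \<open>W\<^sup>-\<^sup>1\<close> occurs only in the
  combination \<open>W\<^sup>-\<^sup>1 \<theta>\<^sup>n\<close>. For fixed \<open>N\<close> this is \<open>diagonalised_recursion_bound\<close>.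

  The stage error involves no accumulation: for small \<open>\<Delta>t\<close> the operator
  \<open>I + \<Delta>t\<^sup>2 \<lambda> A\<close> is a small perturbation of the identity, so its inverse has norm at most 2
  (\<open>norm_le_perturbed_identity\<close>), and \<open>E\<^sup>n\<^sup>+\<^sup>1\<close> inherits the sizes of \<open>e\<^sup>n\<close> and \<open>T\<^sup>n\<close>.
\<close>

section \<open>Euclidean norms and complexification\<close>

lemma norm_cvec [simp]: "norm (cvec v) = norm v"
  by (simp add: cvec_def norm_vec_def)

lemma cvec_zero [simp]: "cvec 0 = 0"
  by (simp add: cvec_def vec_eq_iff)

lemma cvec_add: "cvec (v + w) = cvec v + cvec w"
  by (simp add: cvec_def vec_eq_iff)

lemma cvec_matrix_vector_mult: "cvec (M *v v) = cmatrix M *v cvec v"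
  by (simp add: cvec_def cmatrix_def map_matrix_def matrix_vector_mult_def vec_eq_iff)

lemma norm_mult_le_matrix_norm: "norm (M *v v) \<le> matrix_norm M * norm v"
  unfolding matrix_norm_def by (intro onorm) (rule matrix_vector_mul_bounded_linear)

lemma diagonal_mult_component:
  fixes D :: "complex^'n^'n"
  assumes "\<And>i j. i \<noteq> j \<Longrightarrow> D $ i $ j = 0"
  shows "(D *v v) $ i = D $ i $ i * v $ i"
proof -
  have "(\<Sum>j\<in>UNIV. D $ i $ j * v $ j) = (\<Sum>j\<in>UNIV. if j = i then D $ i $ i * v $ i else 0)"
    by (rule sum.cong) (auto simp: assms)
  then show ?thesis by (simp add: matrix_vector_mult_def)
qed

lemma diagonal_contraction:
  fixes D :: "complex^'n^'n"
  assumes "\<And>i j. i \<noteq> j \<Longrightarrow> D $ i $ j = 0" and "\<And>i. cmod (D $ i $ i) \<le> 1"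
  shows "norm (D *v v) \<le> norm v"
proof (rule norm_le_componentwise_cart)
  fix i
  show "norm ((D *v v) $ i) \<le> norm (v $ i)"
    using mult_right_mono[OF assms(2)[of i] norm_ge_zero[of "v $ i"]]
    by (simp add: diagonal_mult_component[OF assms(1)] norm_mult)
qed

lemma eigen_decomposition_entry_le_spectral_radius:
  assumes "eigen_decomposition M W D"
  shows "cmod (D $ i $ i) \<le> spectral_radius M"
  unfolding spectral_radius_def eigen_decomposition_eigenvalues[OF assms]
  by (rule Max_ge) auto

section \<open>Bounds for a fixed step size\<close>

text \<open>Under a non-expansive map the increments accumulate at most linearly, which is what
  turns a local order into a global order that is lower by one.\<close>

lemma nonexpansive_recursion_bound:
  fixes x r :: "nat \<Rightarrow> 'v::real_normed_vector"
  assumes "\<And>v. norm (L v) \<le> norm v" and "x 0 = 0"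
    and "\<And>n. n < N \<Longrightarrow> x (Suc n) = L (x n) + r n"
    and "\<And>n. n < N \<Longrightarrow> norm (r n) \<le> c"
    and "n \<le> N"
  shows "norm (x n) \<le> real n * c"
  using \<open>n \<le> N\<close>
proof (induction n)
  case 0
  then show ?case by (simp add: assms(2))
next
  case (Suc n)
  then have "norm (x (Suc n)) \<le> norm (L (x n)) + norm (r n)"
    by (simp add: assms(3) norm_triangle_ineq)
  also have "\<dots> \<le> real n * c + c"
    using Suc assms(4)[of n] order_trans[OF assms(1)[of "x n"]] by (intro add_mono) auto
  finally show ?case by (simp add: algebra_simps)
qed

text \<open>The previous lemma cannot be applied to \<open>e\<close>, since \<open>M\<close> may expand the norm; it applies
  to the coordinates of \<open>e\<close> in the eigenbasis, where \<open>M\<close> acts as \<open>D\<close>. The bound \<open>c\<close> is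
  accordingly placed on the coordinates of \<open>\<theta>\<close>.\<close>

lemma diagonalised_recursion_bound:
  fixes M :: "real^'r^'r" and W D :: "complex^'r^'r"
  assumes dec: "eigen_decomposition (cmatrix M) W D"
    and rad: "spectral_radius (cmatrix M) \<le> 1"
    and "e 0 = 0"
    and rec: "\<And>n. n < N \<Longrightarrow> e (Suc n) = M *v e n + \<theta> n"
    and c: "\<And>n. n < N \<Longrightarrow> norm (matrix_inv W *v cvec (\<theta> n)) \<le> c"
    and "n \<le> N"
  shows "norm (e n) \<le> matrix_norm W * (real n * c)"
proof -
  have W: "invertible W" and D: "\<And>i j. i \<noteq> j \<Longrightarrow> D $ i $ j = 0"
    and M: "cmatrix M = W ** D ** matrix_inv W"
    using dec by (auto simp: eigen_decomposition_def)
  have inv: "W ** matrix_inv W = mat 1" "matrix_inv W ** W = mat 1"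
    using W unfolding invertible_def matrix_inv_def by (metis (mono_tags, lifting) someI_ex)+
  define w where "w = (\<lambda>n. matrix_inv W *v cvec (e n))"
  have intertwine: "matrix_inv W *v (cmatrix M *v v) = D *v (matrix_inv W *v v)" for v
    by (simp add: M matrix_vector_mul_assoc matrix_mul_assoc inv)
  have "norm (w n) \<le> real n * c"
  proof (rule nonexpansive_recursion_bound[where L = "\<lambda>v. D *v v" and N = N])
    show "norm (D *v v) \<le> norm v" for v
      using diagonal_contraction[OF D] eigen_decomposition_entry_le_spectral_radius[OF dec]
        order_trans[OF _ rad] by blast
    show "w (Suc n) = D *v w n + matrix_inv W *v cvec (\<theta> n)" if "n < N" for n
      by (simp add: w_def rec[OF that] cvec_add cvec_matrix_vector_mult
          matrix_vector_right_distrib intertwine)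
  qed (use assms in \<open>auto simp: w_def\<close>)
  moreover have "cvec (e n) = W *v w n"
    by (simp add: w_def matrix_vector_mul_assoc inv)
  then have "norm (e n) \<le> matrix_norm W * norm (w n)"
    by (metis norm_cvec norm_mult_le_matrix_norm)
  moreover have "0 \<le> matrix_norm W"
    unfolding matrix_norm_def by (intro onorm_pos_le matrix_vector_mul_bounded_linear)
  ultimately show ?thesis
    by (meson mult_left_mono order_trans)
qed

text \<open>Half of \<open>norm x\<close> survives in \<open>x + k A x\<close>, so the bound
  \<open>\<parallel>(I + k A)\<^sup>-\<^sup>1\<parallel> \<le> 2\<close> holds in the form needed for the stage equation.\<close>

lemma norm_le_perturbed_identity:
  fixes A :: "real^'s^'s"
  assumes "0 \<le> k" "k * onorm (\<lambda>v. A *v v) \<le> 1/2"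
  shows "norm x \<le> 2 * norm (x + k *\<^sub>R (A *v x))"
proof -
  have "norm (A *v x) \<le> onorm (\<lambda>v. A *v v) * norm x"
    by (intro onorm matrix_vector_mul_bounded_linear)
  then have "norm (k *\<^sub>R (A *v x)) \<le> k * (onorm (\<lambda>v. A *v v) * norm x)"
    using assms(1) by (simp add: mult_left_mono)
  also have "\<dots> \<le> 1/2 * norm x"
    using mult_right_mono[OF assms(2) norm_ge_zero[of x]] by (simp add: mult.assoc)
  finally show ?thesis
    using norm_diff_ineq[of x "k *\<^sub>R (A *v x)"] by simp
qed

section \<open>Orders in the step size\<close>

lemma step_size_tendsto_0: "step_size T \<longlonglongrightarrow> 0"
  unfolding step_size_def by (rule lim_const_over_n)

lemma eventually_step_size_pos_le_1:
  assumes "T > 0"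
  shows "\<forall>\<^sub>F N in sequentially. 0 < step_size T N \<and> step_size T N \<le> 1"
proof -
  have "\<forall>\<^sub>F N in sequentially. step_size T N < 1"
    using order_tendstoD(2)[OF step_size_tendsto_0] by simp
  with eventually_gt_at_top[of 0] show ?thesis
    by eventually_elim (use assms in \<open>auto simp: step_size_def\<close>)
qed

text \<open>A negative constant can occur when the index sets are empty or \<open>g\<close> vanishes; a
  nonnegative one is needed to multiply such bounds with each other.\<close>

lemma uniform_bigo_nonneg_constant:
  assumes "uniform_bigo I f g"
  obtains C where "0 \<le> C" "\<forall>\<^sub>F N in sequentially. \<forall>n\<in>I N. norm (f N n) \<le> C * \<bar>g N\<bar>"
proof -
  obtain C where C: "\<forall>\<^sub>F N in sequentially. \<forall>n\<in>I N. norm (f N n) \<le> C * \<bar>g N\<bar>"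
    using assms by (auto simp: uniform_bigo_def)
  show thesis
  proof (rule that[of "\<bar>C\<bar>"])
    show "\<forall>\<^sub>F N in sequentially. \<forall>n\<in>I N. norm (f N n) \<le> \<bar>C\<bar> * \<bar>g N\<bar>"
      using C by eventually_elim (meson abs_ge_self abs_ge_zero mult_right_mono order_trans)
  qed simp
qed

theorem theorem5:
  fixes T lam :: real
    and A :: "real^'s^'s" and U :: "real^'r^'s" and B :: "real^'s^'r" and V :: "real^'r^'r"
    and E Tres :: "nat \<Rightarrow> nat \<Rightarrow> real^'s"
    and e \<theta> :: "nat \<Rightarrow> nat \<Rightarrow> real^'r"
    and W D :: "nat \<Rightarrow> complex^'r^'r"
    and q :: int and a p :: nat
  assumes "T > 0" and "lam > 0" and "a > 0" and "p > 0"
    and stage_eq: "\<forall>\<^sub>F N in sequentially. \<forall>n<N.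
        E N (n + 1) + ((step_size T N)\<^sup>2 * lam) *\<^sub>R (A *v E N (n + 1)) = U *v e N n + Tres N n"
    and step_eq: "\<forall>\<^sub>F N in sequentially. \<forall>n<N.
        e N (n + 1) = G_GLM A U B V lam (step_size T N) *v e N n + \<theta> N n"
    and eigen: "\<forall>\<^sub>F N in sequentially.
        eigen_decomposition (cmatrix (G_GLM A U B V lam (step_size T N))) (W N) (D N)"
    and radius: "\<forall>\<^sub>F N in sequentially.
        spectral_radius (cmatrix (G_GLM A U B V lam (step_size T N))) \<le> 1"
    and init: "\<forall>\<^sub>F N in sequentially. e N 0 = 0 \<and> E N 0 = 0"
    and W_bound: "(\<lambda>N. matrix_norm (W N)) \<in> O(\<lambda>N. step_size T N powi q)"
    and theta_bound: "uniform_bigo (\<lambda>N. {..<N})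
        (\<lambda>N n. matrix_inv (W N) *v cvec (\<theta> N n)) (\<lambda>N. step_size T N ^ (p + 1))"
    and Tres_bound: "uniform_bigo (\<lambda>N. {..<N}) Tres (\<lambda>N. step_size T N ^ (a + 1))"
  shows "uniform_bigo (\<lambda>N. {..N}) e (\<lambda>N. step_size T N powi (q + int p)) \<and>
         uniform_bigo (\<lambda>N. {..N}) E (\<lambda>N. step_size T N powi (min (int a + 1) (q + int p)))"
proof
  let ?h = "step_size T"
  note small = eventually_step_size_pos_le_1[OF \<open>T > 0\<close>]
  obtain Cw where Cw: "0 < Cw"
    "\<forall>\<^sub>F N in sequentially. norm (matrix_norm (W N)) \<le> Cw * norm (?h N powi q)"
    using landau_o.bigE[OF W_bound] by blast
  obtain Ct where Ct: "0 \<le> Ct" "\<forall>\<^sub>F N in sequentially. \<forall>n\<in>{..<N}.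
      norm (matrix_inv (W N) *v cvec (\<theta> N n)) \<le> Ct * \<bar>?h N ^ (p + 1)\<bar>"
    using uniform_bigo_nonneg_constant[OF theta_bound] by blast
  obtain Cr where Cr: "0 \<le> Cr" "\<forall>\<^sub>F N in sequentially. \<forall>n\<in>{..<N}.
      norm (Tres N n) \<le> Cr * \<bar>?h N ^ (a + 1)\<bar>"
    using uniform_bigo_nonneg_constant[OF Tres_bound] by blast

  define Ce where "Ce = Cw * (T * Ct)"
  have Ce: "0 \<le> Ce"
    using Cw(1) Ct(1) \<open>T > 0\<close> by (simp add: Ce_def)
  have e_le: "\<forall>\<^sub>F N in sequentially. \<forall>n\<le>N. norm (e N n) \<le> Ce * ?h N powi (q + int p)"
    using small Cw(2) Ct(2) step_eq eigen radius init eventually_gt_at_top[of 0]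
  proof (eventually_elim, intro allI impI)
    fix N n :: nat
    assume h: "0 < ?h N \<and> ?h N \<le> 1"
      and W: "norm (matrix_norm (W N)) \<le> Cw * norm (?h N powi q)"
      and t: "\<forall>n\<in>{..<N}. norm (matrix_inv (W N) *v cvec (\<theta> N n)) \<le> Ct * \<bar>?h N ^ (p + 1)\<bar>"
      and s: "\<forall>n<N. e N (n + 1) = G_GLM A U B V lam (?h N) *v e N n + \<theta> N n"
      and dec: "eigen_decomposition (cmatrix (G_GLM A U B V lam (?h N))) (W N) (D N)"
      and rad: "spectral_radius (cmatrix (G_GLM A U B V lam (?h N))) \<le> 1"
      and i: "e N 0 = 0 \<and> E N 0 = 0" and N: "0 < N" and n: "n \<le> N"
    have "norm (e N n) \<le> matrix_norm (W N) * (real n * (Ct * ?h N ^ (p + 1)))"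
      by (rule diagonalised_recursion_bound[OF dec rad _ _ _ n, where \<theta> = "\<theta> N"])
        (use i s t h in auto)
    also have "\<dots> \<le> (Cw * ?h N powi q) * (real N * (Ct * ?h N ^ (p + 1)))"
    proof (intro mult_mono)
      show "matrix_norm (W N) \<le> Cw * ?h N powi q"
        using W h by (simp add: power_int_abs)
    qed (use h n Ct(1) Cw(1) in auto)
    \<comment> \<open>\<open>N\<close> steps of length \<open>T / N\<close>: the factor \<open>N\<close> uses up one power of the step size.\<close>
    also have "\<dots> = (Cw * ?h N powi q) * ((real N * ?h N) * Ct * ?h N ^ p)"
      by simp
    also have "real N * ?h N = T"
      using N by (simp add: step_size_def)
    also have "(Cw * ?h N powi q) * (T * Ct * ?h N ^ p) = Ce * ?h N powi (q + int p)"
      using h by (simp add: Ce_def power_int_add)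
    finally show "norm (e N n) \<le> Ce * ?h N powi (q + int p)" .
  qed
  show "uniform_bigo (\<lambda>N. {..N}) e (\<lambda>N. ?h N powi (q + int p))"
    unfolding uniform_bigo_def
  proof (intro exI)
    show "\<forall>\<^sub>F N in sequentially. \<forall>n\<in>{..N}. norm (e N n) \<le> Ce * \<bar>?h N powi (q + int p)\<bar>"
      using e_le small by eventually_elim simp
  qed

  let ?m = "min (int a + 1) (q + int p)"
  let ?u = "onorm (\<lambda>v. U *v v)"
  have u: "0 \<le> ?u"
    by (intro onorm_pos_le matrix_vector_mul_bounded_linear)
  have "(\<lambda>N. (?h N)\<^sup>2 * lam * onorm (\<lambda>v. A *v v)) \<longlonglongrightarrow> 0\<^sup>2 * lam * onorm (\<lambda>v. A *v v)"
    by (intro tendsto_intros step_size_tendsto_0)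
  then have "\<forall>\<^sub>F N in sequentially. (?h N)\<^sup>2 * lam * onorm (\<lambda>v. A *v v) < 1/2"
    by (rule order_tendstoD(2)) simp
  then have "\<forall>\<^sub>F N in sequentially. \<forall>n\<in>{..N}.
      norm (E N n) \<le> 2 * (?u * Ce + Cr) * \<bar>?h N powi ?m\<bar>"
    using small Cr(2) e_le stage_eq init
  proof (eventually_elim, intro ballI)
    fix N n :: nat
    assume k: "(?h N)\<^sup>2 * lam * onorm (\<lambda>v. A *v v) < 1/2"
      and h: "0 < ?h N \<and> ?h N \<le> 1"
      and r: "\<forall>n\<in>{..<N}. norm (Tres N n) \<le> Cr * \<bar>?h N ^ (a + 1)\<bar>"
      and e: "\<forall>n\<le>N. norm (e N n) \<le> Ce * ?h N powi (q + int p)"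
      and s: "\<forall>n<N. E N (n + 1) + ((?h N)\<^sup>2 * lam) *\<^sub>R (A *v E N (n + 1))
        = U *v e N n + Tres N n"
      and i: "e N 0 = 0 \<and> E N 0 = 0" and n: "n \<in> {..N}"
    show "norm (E N n) \<le> 2 * (?u * Ce + Cr) * \<bar>?h N powi ?m\<bar>"
    proof (cases n)
      case 0
      then show ?thesis using i u Ce Cr(1) by simp
    next
      case (Suc j)
      with n have j: "j < N" by simp
      have "norm (U *v e N j) \<le> ?u * norm (e N j)"
        by (intro onorm matrix_vector_mul_bounded_linear)
      also have "\<dots> \<le> ?u * (Ce * ?h N powi (q + int p))"
        using e j u by (intro mult_left_mono) auto
      also have "\<dots> \<le> ?u * (Ce * ?h N powi ?m)"
        using h u Ce by (intro mult_left_mono power_int_decreasing) auto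
      finally have 1: "norm (U *v e N j) \<le> ?u * (Ce * ?h N powi ?m)" .
      have "norm (Tres N j) \<le> Cr * ?h N powi (int (a + 1))"
        using r j h by (simp del: power_Suc of_nat_Suc of_nat_add)
      also have "\<dots> \<le> Cr * ?h N powi ?m"
        using h Cr(1) by (intro mult_left_mono power_int_decreasing) auto
      finally have 2: "norm (Tres N j) \<le> Cr * ?h N powi ?m" .
      have "norm (E N n) \<le> 2 * norm (E N n + ((?h N)\<^sup>2 * lam) *\<^sub>R (A *v E N n))"
        using k \<open>lam > 0\<close> by (intro norm_le_perturbed_identity) auto
      also have "\<dots> = 2 * norm (U *v e N j + Tres N j)"
        using s j Suc by simp
      also have "\<dots> \<le> 2 * (?u * (Ce * ?h N powi ?m) + Cr * ?h N powi ?m)"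
        by (intro mult_left_mono order_trans[OF norm_triangle_ineq] add_mono 1 2) simp
      finally show ?thesis
        using h by (simp add: algebra_simps)
    qed
  qed
  then show "uniform_bigo (\<lambda>N. {..N}) E (\<lambda>N. ?h N powi ?m)"
    unfolding uniform_bigo_def by blast
qed

end
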